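(* Consider a $K$-armed bandit ($K\ge 3$) with a single correct arm $y^*$, deterministic reward $R=\mathbb{I}\{A=y^*\}$, softmax policy $\pi$ with $\pi(y^* )=p\in(0,1)$ and $\pi(a)=(1-p)/(K-1)$ for $a\ne y^*$, and baseline $b\in(0,1)$. Let $U$ be the advantage, $\ell$ the surprisal, and $\chi=U\cdot\ell$ the delight. Then: \begin{enumerate} \item Delight satisfies $\chi(y^* )>0>\chi(a)$ for every $a\neq y^*$, for all $p,K$. \item The additive family $f_\alpha=\alpha U+(1-\alpha)\ell$ achieves sign-separation only when $$\alpha>\alpha^*(p,K)=\frac{L}{1+L},\qquad\text{where } L=\log\!\Big(\frac{p(K-1)}{1-p}\Big).$$ \item Additive mixes require no tuning of $\alpha$ only when $p\le 1/K$ (policy worse than uniform); the moment the policy improves beyond this, tuning of $\alpha$ is required. \end{enumerate}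
   Context: The advantage of an action is its reward minus the baseline: $U(a)=\mathbb{I}\{a=y^*\}-b$, so $U(y^* )=1-b>0$ and $U(a)=-b<0$ for $a\ne y^*$. The surprisal is $\ell(a)=-\log\pi(a)$, and the delight is $\chi(a)=U(a)\,\ell(a)$. The additive score is evaluated per action: $f_\alpha(a)=\alpha U(a)+(1-\alpha)\ell(a)$, with mixing coefficient $\alpha$ interpolating between pure surprisal ($\alpha=0$) and pure advantage ($\alpha=1$). "Sign-separation" of the additive family means that the difference $f_\alpha(y^* )-f_\alpha(a)$ is positive for $a\neq y^*$. "Requires no tuning" means that this separation holds for all $\alpha$; "tuning is required" means that $\alpha$ must be chosen to exceed $\alpha^*(p,K)$.
   Formalization: Item 2 is proved for L > -1 (as an equivalence, α in [0,1]); for L ≤ -1, where α* is undefined or exceeds 1 and the claim fails, every α in [0,1] is shown to separate. At p = 1/K separation holds only for α in (0,1], since it fails at α = 0. *)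

theory Defs
  imports Complex_Main "HOL-Library.Cardinality"
begin

definition softmax :: "('a::finite \<Rightarrow> real) \<Rightarrow> 'a \<Rightarrow> real" where
  "softmax z a = exp (z a) / (\<Sum>a'\<in>UNIV. exp (z a'))"

definition reward :: "'a \<Rightarrow> 'a \<Rightarrow> real" where
  "reward y a = of_bool (a = y)"

definition advantage :: "real \<Rightarrow> 'a \<Rightarrow> 'a \<Rightarrow> real" where
  "advantage b y a = reward y a - b"

definition surprisal :: "('a \<Rightarrow> real) \<Rightarrow> 'a \<Rightarrow> real" where
  "surprisal \<pi> a = - ln (\<pi> a)"

definition delight :: "('a \<Rightarrow> real) \<Rightarrow> real \<Rightarrow> 'a \<Rightarrow> 'a \<Rightarrow> real" where
  "delight \<pi> b y a = advantage b y a * surprisal \<pi> a"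

definition additive_score :: "real \<Rightarrow> ('a \<Rightarrow> real) \<Rightarrow> real \<Rightarrow> 'a \<Rightarrow> 'a \<Rightarrow> real" where
  "additive_score \<alpha> \<pi> b y a = \<alpha> * advantage b y a + (1 - \<alpha>) * surprisal \<pi> a"

definition sign_separates :: "real \<Rightarrow> ('a \<Rightarrow> real) \<Rightarrow> real \<Rightarrow> 'a \<Rightarrow> bool" where
  "sign_separates \<alpha> \<pi> b y \<longleftrightarrow>
     (\<forall>a. a \<noteq> y \<longrightarrow> additive_score \<alpha> \<pi> b y y - additive_score \<alpha> \<pi> b y a > 0)"

definition no_tuning :: "('a \<Rightarrow> real) \<Rightarrow> real \<Rightarrow> 'a \<Rightarrow> bool" where
  "no_tuning \<pi> b y \<longleftrightarrow> (\<forall>\<alpha>\<in>{0..1}. sign_separates \<alpha> \<pi> b y)"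

definition log_ratio :: "real \<Rightarrow> nat \<Rightarrow> real" where
  "log_ratio p K = ln (p * (real K - 1) / (1 - p))"

(* A genuine threshold only for log_ratio p K > -1: at -1 the denominator vanishes, and below -1
   the quotient exceeds 1 although every mixing coefficient in [0,1] separates. *)
definition alpha_star :: "real \<Rightarrow> nat \<Rightarrow> real" where
  "alpha_star p K = log_ratio p K / (1 + log_ratio p K)"

end

theory Submission
  imports Defs
begin

text \<open>
  Under the stated policy every incorrect arm has the same gap
  \<open>\<alpha> - (1 - \<alpha>) L\<close> to the correct one (the baseline cancels),
  where \<open>L\<close> is the log of the ratio of their probabilities. This is affine in \<open>\<alpha>\<close> with
  value \<open>-L\<close> at \<open>0\<close> and \<open>1\<close> at \<open>1\<close>, so everything reduces to the sign of \<open>L\<close>, which is the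
  sign of \<open>p - 1 / K\<close>.
\<close>

text \<open>A probability strictly between 0 and 1 has positive surprisal, so delight inherits the
  sign of the advantage: 1 - b here, - b for an incorrect arm.\<close>

lemma delight_correct_pos:
  assumes "0 < \<pi> y" "\<pi> y < 1" "b < 1"
  shows "delight \<pi> b y y > 0"
  using assms by (simp add: delight_def advantage_def reward_def surprisal_def mult_pos_neg)

lemma delight_incorrect_neg:
  assumes "a \<noteq> y" "0 < \<pi> a" "\<pi> a < 1" "0 < b"
  shows "delight \<pi> b y a < 0"
  using assms by (simp add: delight_def advantage_def reward_def surprisal_def mult_pos_neg)

lemma additive_score_gap:
  assumes "a \<noteq> y" "0 < \<pi> y" "0 < \<pi> a"
  shows "additive_score \<alpha> \<pi> b y y - additive_score \<alpha> \<pi> b y a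
    = \<alpha> - (1 - \<alpha>) * ln (\<pi> y / \<pi> a)"
  using assms
  by (simp add: additive_score_def advantage_def reward_def surprisal_def ln_div algebra_simps)

text \<open>Clearing denominators turns p (K - 1) < 1 - p into p K < 1, so the argument of the
  logarithm crosses 1 exactly at p = 1 / K.\<close>

lemma sign_log_ratio:
  assumes "K \<ge> 2" "0 < p" "p < 1"
  shows "log_ratio p K < 0 \<longleftrightarrow> p < 1 / real K"
    and "log_ratio p K = 0 \<longleftrightarrow> p = 1 / real K"
proof -
  have "0 < p * (real K - 1) / (1 - p)"
    using assms by simp
  then show "log_ratio p K < 0 \<longleftrightarrow> p < 1 / real K"
    and "log_ratio p K = 0 \<longleftrightarrow> p = 1 / real K"
    using assms by (auto simp: log_ratio_def field_simps)
qed

theorem proposition2: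
  fixes z :: "'a::finite \<Rightarrow> real" and \<pi> :: "'a \<Rightarrow> real" and y :: 'a
    and K :: nat and p b :: real
  assumes "CARD('a) = K" and "K \<ge> 3"
    and "\<pi> = softmax z"
    and "0 < p" and "p < 1"
    and "\<pi> y = p"
    and "\<And>a. a \<noteq> y \<Longrightarrow> \<pi> a = (1 - p) / (real K - 1)"
    and "0 < b" and "b < 1"
  shows "(delight \<pi> b y y > 0 \<and> (\<forall>a. a \<noteq> y \<longrightarrow> 0 > delight \<pi> b y a))
    \<and> (log_ratio p K > -1 \<longrightarrow>
         (\<forall>\<alpha>\<in>{0..1}. sign_separates \<alpha> \<pi> b y \<longleftrightarrow> \<alpha> > alpha_star p K))
    \<and> (log_ratio p K \<le> -1 \<longrightarrow> no_tuning \<pi> b y)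
    \<and> (no_tuning \<pi> b y \<longrightarrow> p \<le> 1 / real K)
    \<and> (p < 1 / real K \<longrightarrow> no_tuning \<pi> b y)
    \<and> (p = 1 / real K \<longrightarrow> (\<forall>\<alpha>\<in>{0<..1}. sign_separates \<alpha> \<pi> b y))
    \<and> (p > 1 / real K \<longrightarrow> 0 < alpha_star p K \<and> alpha_star p K < 1 \<and>
         (\<forall>\<alpha>\<in>{0..1}. sign_separates \<alpha> \<pi> b y \<longrightarrow> \<alpha> > alpha_star p K))"
proof -
  define L where "L = log_ratio p K"
  have K: "real K \<ge> 3"
    using assms(2) by simp
  have wrong_pos: "0 < \<pi> a" and wrong_less: "\<pi> a < 1" if "a \<noteq> y" for a
    unfolding assms(7)[OF that] using assms(4,5) K by (simp_all add: field_simps)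
  \<comment> \<open>Without an incorrect arm \<open>sign_separates\<close> would hold vacuously and
    say nothing about the gap.\<close>
  have ex_wrong: "\<exists>a. a \<noteq> y"
  proof (rule ccontr)
    assume "\<nexists>a. a \<noteq> y"
    then have "(UNIV :: 'a set) = {y}"
      by auto
    then have "CARD('a) = card {y}"
      by (rule arg_cong)
    then show False
      using assms(1,2) by simp
  qed
  have gap: "additive_score \<alpha> \<pi> b y y - additive_score \<alpha> \<pi> b y a = \<alpha> - (1 - \<alpha>) * L"
    if "a \<noteq> y" for a \<alpha>
    using additive_score_gap[of a y \<pi> \<alpha> b] wrong_pos[OF that] assms(4,6,7) that
    by (simp add: L_def log_ratio_def)
  have sep: "sign_separates \<alpha> \<pi> b y \<longleftrightarrow> \<alpha> - (1 - \<alpha>) * L > 0" for \<alpha>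
    using ex_wrong gap by (auto simp: sign_separates_def)
  have delight: "delight \<pi> b y y > 0 \<and> (\<forall>a. a \<noteq> y \<longrightarrow> 0 > delight \<pi> b y a)"
    using assms(4-6,8,9) wrong_pos wrong_less
    by (simp add: delight_correct_pos delight_incorrect_neg)
  \<comment> \<open>The gap equals \<alpha> (1 + L) - L; dividing by 1 + L > 0 keeps the direction
    of the inequality.\<close>
  have threshold: "sign_separates \<alpha> \<pi> b y \<longleftrightarrow> \<alpha> > alpha_star p K" if "L > -1" for \<alpha>
    using that unfolding sep alpha_star_def L_def[symmetric] by (simp add: field_simps)
  have tuning_iff: "no_tuning \<pi> b y \<longleftrightarrow> L < 0"
  proof
    assume "no_tuning \<pi> b y"
    then have "sign_separates 0 \<pi> b y"
      by (simp add: no_tuning_def)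
    then show "L < 0"
      by (simp add: sep)
  next
    assume "L < 0"
    have "\<alpha> - (1 - \<alpha>) * L > 0" if "\<alpha> \<in> {0..1}" for \<alpha>
    \<comment> \<open>At \<alpha> = 1 the product (1 - \<alpha>) L vanishes instead of being
      negative, but there the gap is 1.\<close>
    proof (cases "\<alpha> = 1")
      case False
      then have "(1 - \<alpha>) * L < 0"
        using that \<open>L < 0\<close> by (simp add: mult_pos_neg)
      then show ?thesis
        using that by simp
    qed simp
    then show "no_tuning \<pi> b y"
      by (simp add: no_tuning_def sep)
  qed
  have "2 \<le> K"
    using assms(2) by simp
  note sign = sign_log_ratio[OF this assms(4,5), folded L_def]
  have star: "0 < alpha_star p K \<and> alpha_star p K < 1" if "L > 0"
    using that unfolding alpha_star_def L_def[symmetric] by simp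
  have above: "L > 0" if "p > 1 / real K"
    using sign that by linarith
  \<comment> \<open>Here L = 0 and the gap is \<alpha> itself, so within [0, 1] only \<alpha> = 0
    fails to separate.\<close>
  have at_uniform: "sign_separates \<alpha> \<pi> b y" if "p = 1 / real K" "\<alpha> \<in> {0<..1}" for \<alpha>
    using that sign(2) by (simp add: sep)
  show ?thesis
    unfolding L_def[symmetric]
    \<comment> \<open>The case L \<le> -1 falls under \<open>tuning_iff\<close>, and p > 1 / K gives
      L > 0 > -1, so \<open>threshold\<close> applies there.\<close>
    using delight threshold tuning_iff sign star above at_uniform by fastforce
qed

end
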